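(* Let $A,B$ be finite alphabets, $\mathbb{K}$ a semiring, $R\colon A^*\to B^*$ a synchronized relation and $S\colon B^*\to\mathbb{K}$ a $\mathbb{K}$-recognizable series, and suppose that for every $u\in A^*$ the language $\{v\in B^*: uRv\}$ is finite. Then the series $S\circ R\colon A^*\to\mathbb{K}$, $u\mapsto\sum_{v\in B^*,\,uRv}(S,v)$, is $\mathbb{K}$-recognizable.
   Context: A relation $R\colon A^*\to B^*$ is identified with its graph $\mathcal{G}_R=\{(u,v)\in A^*\times B^*: uRv\}$. Let $\$\notin A\cup B$. For $(u,v)\in A^*\times B^*$, $(u,v)^\$$ denotes the word over the alphabet $\big((A\cup\{\$\})\times(B\cup\{\$\})\big)\setminus\{(\$,\$)\}$ obtained by padding the shorter of $u,v$ on the left with $\$$'s to the length of the longer one and reading the two words in parallel. $R$ is synchronized if the language $\{(u,v)^\$:(u,v)\in\mathcal{G}_R\}$ is regular. A series $S\colon B^*\to\mathbb{K}$ (coefficients $(S,v)$) is $\mathbb{K}$-recognizable if there exist $r\ge1$, a monoid morphism $\mu\colon B^*\to\mathbb{K}^{r\times r}$, $\lambda\in\mathbb{K}^{1\times r}$, $\gamma\in\mathbb{K}^{r\times1}$ with $(S,v)=\lambda\mu(v)\gamma$ for all $v\in B^*$. *)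

theory Defs
  imports "Jordan_Normal_Form.Matrix"
begin

text \<open>An alphabet is a finite set \<open>A\<close>, and the free monoid on it is \<open>lists A\<close>.
  A series on \<open>lists A\<close> is a function on lists, of which only the restriction to \<open>lists A\<close> matters.\<close>

text \<open>A language is regular if it is accepted by a complete deterministic finite automaton.
  Taking the states to be natural numbers only fixes their names.\<close>

definition regular_lang :: "'c set \<Rightarrow> 'c list set \<Rightarrow> bool" where
  "regular_lang C L \<longleftrightarrow>
    (\<exists>(Q :: nat set) \<delta> q0 F. finite Q \<and> q0 \<in> Q \<and> F \<subseteq> Q
      \<and> (\<forall>q\<in>Q. \<forall>c\<in>C. \<delta> q c \<in> Q)
      \<and> L = {w \<in> lists C. foldl \<delta> q0 w \<in> F})"

text \<open>The padding symbol is \<open>None\<close>; a letter \<open>a\<close> is embedded as \<open>Some a\<close>.\<close>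

definition pad_alphabet :: "'a set \<Rightarrow> 'b set \<Rightarrow> ('a option \<times> 'b option) set" where
  "pad_alphabet A B =
    (insert None (Some ` A)) \<times> (insert None (Some ` B)) - {(None, None)}"

definition pad_left :: "nat \<Rightarrow> 'a list \<Rightarrow> 'a option list" where
  "pad_left n w = replicate (n - length w) None @ map Some w"

definition pad_pair :: "'a list \<Rightarrow> 'b list \<Rightarrow> ('a option \<times> 'b option) list" where
  "pad_pair u v =
    (let n = max (length u) (length v) in zip (pad_left n u) (pad_left n v))"

definition synchronized :: "'a set \<Rightarrow> 'b set \<Rightarrow> ('a list \<times> 'b list) set \<Rightarrow> bool" where
  "synchronized A B R \<longleftrightarrow>
    regular_lang (pad_alphabet A B) {pad_pair u v | u v. (u, v) \<in> R}"

text \<open>The sort \<open>{semiring_0, monoid_mult}\<close> is that of semirings with 0 and 1 and a possibly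
  noncommutative product; unlike \<open>semiring_1\<close> it does not require \<open>0 \<noteq> 1\<close>.\<close>

definition recognizable ::
  "'b set \<Rightarrow> ('b list \<Rightarrow> 'k :: {semiring_0, monoid_mult}) \<Rightarrow> bool" where
  "recognizable B S \<longleftrightarrow>
    (\<exists>r \<ge> 1. \<exists>(\<mu> :: 'b list \<Rightarrow> 'k mat) l g.
      (\<forall>v \<in> lists B. \<mu> v \<in> carrier_mat r r)
      \<and> \<mu> [] = 1\<^sub>m r
      \<and> (\<forall>v \<in> lists B. \<forall>w \<in> lists B. \<mu> (v @ w) = \<mu> v * \<mu> w)
      \<and> l \<in> carrier_mat 1 r \<and> g \<in> carrier_mat r 1
      \<and> (\<forall>v \<in> lists B. S v = (l * \<mu> v * g) $$ (0, 0)))"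

end

theory Submission
  imports Defs
begin

text \<open>A series is recognizable iff it lies in a finitely generated left submodule of series that
  is stable under the shifts \<open>f \<mapsto> (\<lambda>u. f (a # u))\<close>. Let \<open>g\<^sub>i\<close> be generators of such a module for
  \<open>S\<close>, with \<open>S (w @ v) = (\<Sum>i. \<rho>\<^sub>i w * g\<^sub>i v)\<close>. For a state \<open>q\<close> of the automaton reading padded
  pairs, sum \<open>g\<^sub>i v\<close> over all \<open>v\<close> such that \<open>(u, v)\<close> is accepted from \<open>q\<close>, once over the \<open>v\<close> of the
  same length as \<open>u\<close> and once over the \<open>v\<close> of at most that length. These finitely many series span
  a stable module containing the part of \<open>S \<circ> R\<close> with \<open>\<bar>v\<bar> \<le> \<bar>u\<bar>\<close>. A longer \<open>v\<close> splits
  as \<open>w @ v'\<close> with \<open>\<bar>v'\<bar> = \<bar>u\<bar>\<close>, where \<open>u\<close> influences the prefix \<open>w\<close> only through the state \<open>q\<close>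
  reached after it; the coefficient of the series for \<open>q\<close> is the sum of \<open>\<rho>\<^sub>i w\<close> over these
  \<open>w\<close>. If there are infinitely many such \<open>w\<close>, then the finiteness hypothesis on \<open>R\<close> forces
  the equal-length series for \<open>q\<close> to vanish.\<close>

section \<open>Recognizability by shift-stable modules\<close>

text \<open>Scalars stand on the left because the product need not commute. Agreement is required on
  \<open>U\<close> only: outside \<open>lists A\<close> the values of a series are
  arbitrary.\<close>

definition lspan :: "'x set \<Rightarrow> ('x \<Rightarrow> 'k :: {semiring_0, monoid_mult}) set \<Rightarrow> ('x \<Rightarrow> 'k) set" where
  "lspan U F = {h. \<exists>c. \<forall>u\<in>U. h u = (\<Sum>f\<in>F. c f * f u)}"

lemma lspan_cong: "h \<in> lspan U F \<Longrightarrow> (\<And>u. u \<in> U \<Longrightarrow> h' u = h u) \<Longrightarrow> h' \<in> lspan U F"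
  unfolding lspan_def by auto

lemma lspan_base:
  assumes "finite F" "f \<in> F"
  shows "f \<in> lspan U F"
proof -
  have "f u = (\<Sum>g\<in>F. (if g = f then 1 else 0) * g u)" for u
  proof -
    have "(\<Sum>g\<in>F. (if g = f then 1 else 0) * g u) = (\<Sum>g\<in>F. if g = f then g u else 0)"
      by (intro sum.cong) auto
    also have "\<dots> = f u"
      using assms by simp
    finally show ?thesis by simp
  qed
  then show ?thesis
    unfolding lspan_def by (auto intro!: exI[of _ "\<lambda>g. if g = f then 1 else 0"])
qed

lemma lspan_zero: "(\<lambda>u. 0) \<in> lspan U F"
  unfolding lspan_def by (auto intro!: exI[of _ "\<lambda>_. 0"])

lemma lspan_add:
  assumes "h \<in> lspan U F" "k \<in> lspan U F"
  shows "(\<lambda>u. h u + k u) \<in> lspan U F"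
proof -
  obtain c d where "\<forall>u\<in>U. h u = (\<Sum>f\<in>F. c f * f u)" "\<forall>u\<in>U. k u = (\<Sum>f\<in>F. d f * f u)"
    using assms unfolding lspan_def by auto
  then have "\<forall>u\<in>U. h u + k u = (\<Sum>f\<in>F. (c f + d f) * f u)"
    by (simp add: distrib_right sum.distrib)
  then show ?thesis
    unfolding lspan_def by (intro CollectI exI)
qed

lemma lspan_scale:
  assumes "h \<in> lspan U F"
  shows "(\<lambda>u. x * h u) \<in> lspan U F"
proof -
  obtain c where "\<forall>u\<in>U. h u = (\<Sum>f\<in>F. c f * f u)"
    using assms unfolding lspan_def by auto
  then have "\<forall>u\<in>U. x * h u = (\<Sum>f\<in>F. (x * c f) * f u)"
    by (simp add: sum_distrib_left mult.assoc)
  then show ?thesis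
    unfolding lspan_def by (intro CollectI exI)
qed

lemma lspan_sum:
  assumes "\<And>i. i \<in> I \<Longrightarrow> h i \<in> lspan U F"
  shows "(\<lambda>u. \<Sum>i\<in>I. h i u) \<in> lspan U F"
  using assms by (induction I rule: infinite_finite_induct) (auto intro: lspan_zero lspan_add)

text \<open>The library states the unit laws for matrices over \<open>semiring_1\<close>, which excludes \<open>0 = 1\<close>.\<close>

lemma mat_one_mult:
  fixes X :: "'k :: {semiring_0, monoid_mult} mat"
  assumes "X \<in> carrier_mat n m"
  shows "1\<^sub>m n * X = X"
proof (rule eq_matI)
  fix i j assume ij: "i < dim_row X" "j < dim_col X"
  have "(1\<^sub>m n * X) $$ (i, j) = (\<Sum>k<n. (if i = k then 1 else 0) * X $$ (k, j))"
    using assms ij by (auto simp: scalar_prod_def atLeast0LessThan intro!: sum.cong)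
  also have "\<dots> = (\<Sum>k<n. if i = k then X $$ (k, j) else 0)"
    by (intro sum.cong) auto
  also have "\<dots> = X $$ (i, j)"
    using assms ij by simp
  finally show "(1\<^sub>m n * X) $$ (i, j) = X $$ (i, j)" .
qed (use assms in auto)

lemma mat_mult_entry:
  assumes "X \<in> carrier_mat n k" "Y \<in> carrier_mat k m" "i < n" "j < m"
  shows "(X * Y) $$ (i, j) = (\<Sum>p<k. X $$ (i, p) * Y $$ (p, j))"
  using assms by (auto simp: scalar_prod_def atLeast0LessThan intro!: sum.cong)

text \<open>Enumerate the generators as \<open>e 0\<close>, ..., \<open>e (r - 1)\<close>. Row
  \<open>i\<close> of \<open>M a\<close> holds coefficients of the shift of \<open>e i\<close> by
  \<open>a\<close>, and \<open>g\<close> holds the values at the empty word. Induction on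
  \<open>u\<close> then shows that the column \<open>\<mu> u * g\<close> lists the values
  \<open>e i u\<close>, and the row \<open>l\<close> combines them to \<open>h u\<close>.\<close>

lemma recognizable_if_mem_lspan:
  fixes F :: "('a list \<Rightarrow> 'k :: {semiring_0, monoid_mult}) set"
  assumes fin: "finite F" and ne: "F \<noteq> {}"
    and shift: "\<And>f a. f \<in> F \<Longrightarrow> a \<in> A \<Longrightarrow> (\<lambda>u. f (a # u)) \<in> lspan (lists A) F"
    and h: "h \<in> lspan (lists A) F"
  shows "recognizable A h"
proof -
  define r where "r = card F"
  obtain e where e: "bij_betw e {..<r} F"
    unfolding r_def using fin ex_bij_betw_nat_finite lessThan_atLeast0 by metis
  have r: "r \<ge> 1"
    using fin ne unfolding r_def by (simp add: Suc_le_eq card_gt_0_iff)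
  have "\<forall>f a. \<exists>c. f \<in> F \<longrightarrow> a \<in> A \<longrightarrow> (\<forall>u\<in>lists A. f (a # u) = (\<Sum>g\<in>F. c g * g u))"
    using shift unfolding lspan_def by blast
  then obtain c where c: "\<And>f a u. f \<in> F \<Longrightarrow> a \<in> A \<Longrightarrow> u \<in> lists A \<Longrightarrow>
      f (a # u) = (\<Sum>g\<in>F. c f a g * g u)"
    by metis
  obtain d where d: "\<And>u. u \<in> lists A \<Longrightarrow> h u = (\<Sum>g\<in>F. d g * g u)"
    using h unfolding lspan_def by auto
  define M where "M a = mat r r (\<lambda>(i, j). c (e i) a (e j))" for a
  define \<mu> where "\<mu> w = foldr (\<lambda>a X. M a * X) w (1\<^sub>m r)" for w
  define l where "l = mat 1 r (\<lambda>(i, j). d (e j))"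
  define g where "g = mat r 1 (\<lambda>(i, j). e i [])"
  have M: "M a \<in> carrier_mat r r" for a
    unfolding M_def by simp
  have \<mu>: "\<mu> w \<in> carrier_mat r r" for w
    unfolding \<mu>_def by (induction w) (auto intro: mult_carrier_mat[OF M])
  have \<mu>_Nil: "\<mu> [] = 1\<^sub>m r" and \<mu>_Cons: "\<And>a w. \<mu> (a # w) = M a * \<mu> w"
    unfolding \<mu>_def by simp_all
  have append: "\<mu> (v @ w) = \<mu> v * \<mu> w" for v w
  proof (induction v)
    case Nil
    then show ?case using mat_one_mult[OF \<mu>] \<mu>_Nil by simp
  next
    case (Cons a v)
    then show ?case using assoc_mult_mat[OF M \<mu> \<mu>] \<mu>_Cons by simp
  qed
  have l: "l \<in> carrier_mat 1 r" and g: "g \<in> carrier_mat r 1"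
    unfolding l_def g_def by auto
  have \<mu>g: "\<mu> u * g = mat r 1 (\<lambda>(i, j). e i u)" if "u \<in> lists A" for u
    using that
  proof induction
    case Nil
    then show ?case using mat_one_mult[OF g] \<mu>_Nil by (simp add: g_def)
  next
    case (Cons a u)
    have "\<mu> (a # u) * g = M a * mat r 1 (\<lambda>(i, j). e i u)"
      using assoc_mult_mat[OF M \<mu> g] Cons \<mu>_Cons by simp
    also have "\<dots> = mat r 1 (\<lambda>(i, j). e i (a # u))"
    proof (rule eq_matI)
      fix i j
      assume "i < dim_row (mat r 1 (\<lambda>(i, j). e i (a # u)))" "j < dim_col (mat r 1 (\<lambda>(i, j). e i (a # u)))"
      then have ij: "i < r" "j < 1" by auto
      then have ei: "e i \<in> F" using e by (auto simp: bij_betw_def)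
      have "(M a * mat r 1 (\<lambda>(i, j). e i u)) $$ (i, j) = (\<Sum>p<r. c (e i) a (e p) * e p u)"
        using ij by (subst mat_mult_entry[OF M _ ij]) (auto simp: M_def)
      also have "\<dots> = (\<Sum>g\<in>F. c (e i) a g * g u)"
        using sum.reindex_bij_betw[OF e, of "\<lambda>g. c (e i) a g * g u"] .
      also have "\<dots> = e i (a # u)"
        using c[OF ei] Cons by simp
      finally show "(M a * mat r 1 (\<lambda>(i, j). e i u)) $$ (i, j) = mat r 1 (\<lambda>(i, j). e i (a # u)) $$ (i, j)"
        using ij by simp
    qed (use M[of a] in auto)
    finally show ?case .
  qed
  have "h u = (l * \<mu> u * g) $$ (0, 0)" if u: "u \<in> lists A" for u
  proof -
    have "(l * \<mu> u * g) $$ (0, 0) = (l * mat r 1 (\<lambda>(i, j). e i u)) $$ (0, 0)"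
      using assoc_mult_mat[OF l \<mu> g] \<mu>g[OF u] by simp
    also have "\<dots> = (\<Sum>p<r. d (e p) * e p u)"
      by (subst mat_mult_entry[OF l]) (auto simp: l_def)
    also have "\<dots> = (\<Sum>g\<in>F. d g * g u)"
      using sum.reindex_bij_betw[OF e, of "\<lambda>g. d g * g u"] .
    finally show ?thesis using d[OF u] by simp
  qed
  then show ?thesis
    unfolding recognizable_def using r \<mu> \<mu>_Nil append l g
    by (intro exI[of _ r] exI[of _ \<mu>] exI[of _ l] exI[of _ g] conjI ballI) simp_all
qed

text \<open>The product \<open>l * \<mu> w * \<mu> v * G\<close> is cut in the middle:
  \<open>\<rho> w\<close> is the row \<open>l * \<mu> w\<close>, and the \<open>g j v\<close> are
  the entries of the column \<open>\<mu> v * G\<close>. The matrices of single letters give the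
  shifts of the \<open>g j\<close>.\<close>

lemma recognizable_obtain_generators:
  fixes S :: "'b list \<Rightarrow> 'k :: {semiring_0, monoid_mult}"
  assumes "recognizable B S"
  obtains r :: nat and \<rho> :: "'b list \<Rightarrow> nat \<Rightarrow> 'k" and g :: "nat \<Rightarrow> 'b list \<Rightarrow> 'k" and M
  where "r \<ge> 1"
    and "\<forall>w\<in>lists B. \<forall>v\<in>lists B. S (w @ v) = (\<Sum>j<r. \<rho> w j * g j v)"
    and "\<forall>i<r. \<forall>b\<in>B. \<forall>v\<in>lists B. g i (b # v) = (\<Sum>j<r. M b i j * g j v)"
proof -
  obtain r \<mu> l G where r: "r \<ge> 1"
    and \<mu>: "\<And>v. v \<in> lists B \<Longrightarrow> \<mu> v \<in> carrier_mat r r"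
    and app: "\<And>v w. v \<in> lists B \<Longrightarrow> w \<in> lists B \<Longrightarrow> \<mu> (v @ w) = \<mu> v * \<mu> w"
    and l: "l \<in> carrier_mat 1 r" and G: "G \<in> carrier_mat r 1"
    and S: "\<And>v. v \<in> lists B \<Longrightarrow> S v = (l * \<mu> v * G) $$ (0, 0)"
    using assms unfolding recognizable_def by blast
  show thesis
  proof (rule that[OF r, of "\<lambda>w j. (l * \<mu> w) $$ (0, j)" "\<lambda>j v. (\<mu> v * G) $$ (j, 0)"
        "\<lambda>b i j. \<mu> [b] $$ (i, j)"]; intro ballI allI impI)
    fix w v assume w: "w \<in> lists B" and v: "v \<in> lists B"
    have "l * (\<mu> w * \<mu> v) * G = (l * \<mu> w) * (\<mu> v * G)"
      using assoc_mult_mat[OF l \<mu>[OF w] \<mu>[OF v]]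
        assoc_mult_mat[OF mult_carrier_mat[OF l \<mu>[OF w]] \<mu>[OF v] G] by simp
    then show "S (w @ v) = (\<Sum>j<r. (l * \<mu> w) $$ (0, j) * (\<mu> v * G) $$ (j, 0))"
      using w v S[of "w @ v"] app mat_mult_entry[OF mult_carrier_mat[OF l \<mu>[OF w]] mult_carrier_mat[OF \<mu>[OF v] G]]
      by simp
  next
    fix i b v assume i: "i < r" and b: "b \<in> B" and v: "v \<in> lists B"
    have b': "[b] \<in> lists B" using b by simp
    have "\<mu> (b # v) * G = \<mu> [b] * (\<mu> v * G)"
      using app[OF b' v] assoc_mult_mat[OF \<mu>[OF b'] \<mu>[OF v] G] by simp
    then show "(\<mu> (b # v) * G) $$ (i, 0) = (\<Sum>j<r. \<mu> [b] $$ (i, j) * (\<mu> v * G) $$ (j, 0))"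
      using mat_mult_entry[OF \<mu>[OF b'] mult_carrier_mat[OF \<mu>[OF v] G] i] by simp
  qed
qed

section \<open>Padded pairs\<close>

lemma map_filter_pad_left: "List.map_filter id (pad_left n w) = w"
  by (simp add: pad_left_def map_filter_def)

lemma length_pad_left: "length w \<le> n \<Longrightarrow> length (pad_left n w) = n"
  by (simp add: pad_left_def)

text \<open>Each projection of the padded pair is a padded word, and deleting \<open>None\<close>
  recovers the word itself.\<close>

lemma pad_pair_inject: "pad_pair u v = pad_pair u' v' \<longleftrightarrow> u = u' \<and> v = v'"
proof -
  have "map fst (pad_pair u v) = pad_left (max (length u) (length v)) u"
    "map snd (pad_pair u v) = pad_left (max (length u) (length v)) v" for u :: "'a list" and v :: "'b list"
    by (simp_all add: pad_pair_def Let_def length_pad_left)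
  then show ?thesis
    by (metis map_filter_pad_left)
qed

lemma pad_pair_Nil: "pad_pair [] [] = []"
  by (simp add: pad_pair_def pad_left_def)

lemma pad_pair_Cons_Cons:
  "length u = length v \<Longrightarrow> pad_pair (a # u) (b # v) = (Some a, Some b) # pad_pair u v"
  by (simp add: pad_pair_def pad_left_def)

lemma pad_pair_Cons_left:
  "length v \<le> length u \<Longrightarrow> pad_pair (a # u) v = (Some a, None) # pad_pair u v"
  by (simp add: pad_pair_def pad_left_def Suc_diff_le max_def)

text \<open>The surplus prefix \<open>w\<close> meets only padding, so the state reached after it
  does not depend on \<open>u\<close>.\<close>

lemma pad_pair_append_right:
  "length v = length u \<Longrightarrow> pad_pair u (w @ v) = map (\<lambda>b. (None, Some b)) w @ pad_pair u v"
  by (induction w) (auto simp: pad_pair_def pad_left_def Suc_diff_le max_def zip_append1 zip_replicate1 comp_def)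

lemma pad_pair_lists:
  assumes "u \<in> lists A" "v \<in> lists B"
  shows "pad_pair u v \<in> lists (pad_alphabet A B)"
proof -
  have le: "pad_pair u v \<in> lists (pad_alphabet A B)"
    if "length v \<le> length u" "u \<in> lists A" "v \<in> lists B" for u v
    using that(2,1,3)
  proof (induction arbitrary: v)
    case Nil
    then show ?case by (simp add: pad_pair_Nil)
  next
    case (Cons a u)
    show ?case
    proof (cases "length v \<le> length u")
      case True
      then show ?thesis using Cons by (simp add: pad_pair_Cons_left) (auto simp: pad_alphabet_def)
    next
      case False
      then obtain b v' where "v = b # v'" "length v' = length u"
        using Cons.prems by (cases v) auto
      then show ?thesis using Cons by (simp add: pad_pair_Cons_Cons) (auto simp: pad_alphabet_def)
    qed
  qed
  show ?thesis
  proof (cases "length v \<le> length u")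
    case True
    then show ?thesis using le assms by blast
  next
    case False
    \<comment> \<open>Splitting off the surplus prefix leaves a suffix as long as \<open>u\<close>,
      to which \<open>le\<close> applies.\<close>
    define w v' where "w = take (length v - length u) v" and "v' = drop (length v - length u) v"
    have v: "v = w @ v'" and len: "length v' = length u"
      using False by (auto simp: w_def v'_def)
    have mem: "w \<in> lists B" "v' \<in> lists B" using assms v by auto
    then have "pad_pair u v' \<in> lists (pad_alphabet A B)" using le assms len by simp
    then show ?thesis
      using mem unfolding v pad_pair_append_right[OF len]
      by (auto simp: pad_alphabet_def)
  qed
qed

text \<open>Injectivity of padding turns acceptance of the word \<open>pad_pair u v\<close> into
  membership of this very pair in \<open>R\<close>.\<close>

lemma synchronized_obtain_automaton:
  assumes "synchronized A B R" "R \<subseteq> lists A \<times> lists B"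
  obtains Q :: "nat set" and q0 \<delta> F
  where "finite Q" "q0 \<in> Q" "\<And>q c. q \<in> Q \<Longrightarrow> c \<in> pad_alphabet A B \<Longrightarrow> \<delta> q c \<in> Q"
    and "\<And>u v. u \<in> lists A \<Longrightarrow> v \<in> lists B \<Longrightarrow> (u, v) \<in> R \<longleftrightarrow> foldl \<delta> q0 (pad_pair u v) \<in> F"
proof -
  obtain Q :: "nat set" and \<delta> q0 F where *: "finite Q" "q0 \<in> Q"
    "\<And>q c. q \<in> Q \<Longrightarrow> c \<in> pad_alphabet A B \<Longrightarrow> \<delta> q c \<in> Q"
    and L: "{pad_pair u v | u v. (u, v) \<in> R} = {w \<in> lists (pad_alphabet A B). foldl \<delta> q0 w \<in> F}"
    using assms(1) unfolding synchronized_def regular_lang_def by blast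
  have "(u, v) \<in> R \<longleftrightarrow> foldl \<delta> q0 (pad_pair u v) \<in> F" if "u \<in> lists A" "v \<in> lists B" for u v
  proof -
    have "(u, v) \<in> R \<longleftrightarrow> pad_pair u v \<in> {pad_pair u v | u v. (u, v) \<in> R}"
      by (auto simp: pad_pair_inject)
    then show ?thesis
      unfolding L using pad_pair_lists[OF that] by simp
  qed
  then show thesis using that * by blast
qed

lemma foldl_mem:
  assumes "\<And>q c. q \<in> Q \<Longrightarrow> c \<in> C \<Longrightarrow> \<delta> q c \<in> Q" "q \<in> Q" "w \<in> lists C"
  shows "foldl \<delta> q w \<in> Q"
  using assms(3,2) by (induction arbitrary: q) (auto simp: assms(1))

section \<open>Composition with a synchronized relation\<close>

theorem theorem9p2:
  fixes A :: "'a set" and B :: "'b set"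
    and R :: "('a list \<times> 'b list) set"
    and S :: "'b list \<Rightarrow> 'k :: {semiring_0, monoid_mult}"
  assumes "finite A" and "finite B"
    and "R \<subseteq> lists A \<times> lists B"
    and "synchronized A B R"
    and "recognizable B S"
    and "\<And>u. u \<in> lists A \<Longrightarrow> finite (R `` {u})"
  shows "recognizable A (\<lambda>u. \<Sum>v \<in> R `` {u}. S v)"
proof -
  obtain Q :: "nat set" and q0 \<delta> Fin where Q: "finite Q" "q0 \<in> Q"
    and \<delta>: "\<And>q c. q \<in> Q \<Longrightarrow> c \<in> pad_alphabet A B \<Longrightarrow> \<delta> q c \<in> Q"
    and R: "\<And>u v. u \<in> lists A \<Longrightarrow> v \<in> lists B \<Longrightarrow> (u, v) \<in> R \<longleftrightarrow> foldl \<delta> q0 (pad_pair u v) \<in> Fin"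
    using synchronized_obtain_automaton[OF assms(4,3)] by metis
  obtain r :: nat and \<rho> g M where r: "r \<ge> 1"
    and "\<forall>w\<in>lists B. \<forall>v\<in>lists B. S (w @ v) = (\<Sum>j<r. \<rho> w j * g j v)"
    and "\<forall>i<r. \<forall>b\<in>B. \<forall>v\<in>lists B. g i (b # v) = (\<Sum>j<r. M b i j * g j v)"
    by (rule recognizable_obtain_generators[OF assms(5)])
  then have S: "\<And>w v. w \<in> lists B \<Longrightarrow> v \<in> lists B \<Longrightarrow> S (w @ v) = (\<Sum>j<r. \<rho> w j * g j v)"
    and g: "\<And>i b v. i < r \<Longrightarrow> b \<in> B \<Longrightarrow> v \<in> lists B \<Longrightarrow> g i (b # v) = (\<Sum>j<r. M b i j * g j v)"
    by blast+
  define Eq where "Eq q u = {v \<in> lists B. length v = length u \<and> foldl \<delta> q (pad_pair u v) \<in> Fin}"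
    for q and u :: "'a list"
  define Le where "Le q u = {v \<in> lists B. length v \<le> length u \<and> foldl \<delta> q (pad_pair u v) \<in> Fin}"
    for q and u :: "'a list"
  define E where "E q i u = (\<Sum>v\<in>Eq q u. g i v)" for q i u
  define P where "P q i u = (\<Sum>v\<in>Le q u. g i v)" for q i u
  \<comment> \<open>The generators form a set, so series that coincide for different
    \<open>(q, i)\<close> are merged.\<close>
  define F where "F = (\<lambda>(q, i). E q i) ` (Q \<times> {..<r}) \<union> (\<lambda>(q, i). P q i) ` (Q \<times> {..<r})"
  have finLe: "finite (Le q u)" for q u
    by (rule finite_subset[OF _ finite_lists_length_le[OF assms(2), of "length u"]])
      (auto simp: Le_def)
  have finEq: "finite (Eq q u)" for q u
    by (rule finite_subset[OF _ finLe[of q u]]) (auto simp: Eq_def Le_def)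
  have finF: "finite F"
    using Q by (simp add: F_def)
  have neF: "F \<noteq> {}"
    using Q r by (auto simp: F_def lessThan_empty_iff)
  have E_span: "E q i \<in> lspan U F" and P_span: "P q i \<in> lspan U F" if "q \<in> Q" "i < r" for q i U
    by (rule lspan_base[OF finF]; use that in \<open>force simp: F_def\<close>)+
  have \<delta>S: "\<delta> q (Some a, Some b) \<in> Q" if "q \<in> Q" "a \<in> A" "b \<in> B" for q a b
    using that by (auto intro!: \<delta> simp: pad_alphabet_def)
  have \<delta>N: "\<delta> q (Some a, None) \<in> Q" if "q \<in> Q" "a \<in> A" for q a
    using that by (auto intro!: \<delta> simp: pad_alphabet_def)
  \<comment> \<open>A word as long as \<open>a # u\<close> has a first letter \<open>b\<close>,
    which is read in parallel with \<open>a\<close>.\<close>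
  have Eq_Cons: "Eq q (a # u) = (\<lambda>(b, v). b # v) ` (SIGMA b:B. Eq (\<delta> q (Some a, Some b)) u)" for q a u
  proof (intro equalityI subsetI)
    fix v assume v: "v \<in> Eq q (a # u)"
    then obtain b v' where "v = b # v'" by (cases v) (auto simp: Eq_def)
    then show "v \<in> (\<lambda>(b, v). b # v) ` (SIGMA b:B. Eq (\<delta> q (Some a, Some b)) u)"
      using v by (auto simp: Eq_def pad_pair_Cons_Cons intro!: image_eqI[of _ _ "(b, v')"])
  qed (auto simp: Eq_def pad_pair_Cons_Cons)
  have E_Cons: "E q i (a # u) = (\<Sum>b\<in>B. \<Sum>j<r. M b i j * E (\<delta> q (Some a, Some b)) j u)"
    if "i < r" for q i a u
  proof -
    have "E q i (a # u) = (\<Sum>(b, v)\<in>(SIGMA b:B. Eq (\<delta> q (Some a, Some b)) u). g i (b # v))"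
      unfolding E_def Eq_Cons by (subst sum.reindex) (auto simp: inj_on_def intro!: sum.cong)
    also have "\<dots> = (\<Sum>b\<in>B. \<Sum>v\<in>Eq (\<delta> q (Some a, Some b)) u. g i (b # v))"
      using assms(2) finEq by (subst sum.Sigma) auto
    also have "\<dots> = (\<Sum>b\<in>B. \<Sum>v\<in>Eq (\<delta> q (Some a, Some b)) u. \<Sum>j<r. M b i j * g j v)"
      using that by (intro sum.cong refl g) (auto simp: Eq_def)
    also have "\<dots> = (\<Sum>b\<in>B. \<Sum>j<r. M b i j * E (\<delta> q (Some a, Some b)) j u)"
      unfolding E_def sum_distrib_left by (intro sum.cong refl sum.swap)
    finally show ?thesis .
  qed
  \<comment> \<open>A word of at most the length of \<open>a # u\<close> either has exactly that
    length, or is no longer than \<open>u\<close>, and then \<open>a\<close> is read against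
    padding. This is why the module also needs the equal-length series.\<close>
  have P_Cons: "P q i (a # u) = E q i (a # u) + P (\<delta> q (Some a, None)) i u" for q i a u
  proof -
    have "Le q (a # u) = Eq q (a # u) \<union> Le (\<delta> q (Some a, None)) u"
      by (auto simp: Le_def Eq_def pad_pair_Cons_left le_Suc_eq)
    moreover have "Eq q (a # u) \<inter> Le (\<delta> q (Some a, None)) u = {}"
      by (auto simp: Le_def Eq_def)
    ultimately show ?thesis
      by (simp add: P_def E_def sum.union_disjoint[OF finEq finLe])
  qed
  have E_shift: "(\<lambda>u. E q i (a # u)) \<in> lspan (lists A) F" if "q \<in> Q" "i < r" "a \<in> A" for q i a
    unfolding E_Cons[OF that(2)]
    by (intro lspan_sum lspan_scale E_span) (use that \<delta>S in auto)
  have P_shift: "(\<lambda>u. P q i (a # u)) \<in> lspan (lists A) F" if "q \<in> Q" "i < r" "a \<in> A" for q i a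
    unfolding P_Cons by (intro lspan_add E_shift P_span that \<delta>N)
  \<comment> \<open>Excluding the empty prefix keeps the long words disjoint from
    \<open>Le q0 u\<close>, which already contains those as long as \<open>u\<close>.\<close>
  define W where "W q = {w \<in> lists B. w \<noteq> [] \<and> foldl \<delta> q0 (map (\<lambda>b. (None, Some b)) w) = q}" for q
  \<comment> \<open>For infinite \<open>W q\<close> this sum is 0 by convention. The value is
    harmless, since \<open>Eq_empty\<close> below makes \<open>E q j u\<close> vanish for such
    \<open>q\<close> in \<open>Q\<close> and all \<open>u\<close> in \<open>lists A\<close>.\<close>
  define L where "L q j = (\<Sum>w\<in>W q. \<rho> w j)" for q j
  have short: "(\<Sum>v\<in>Le q0 u. S v) = (\<Sum>i<r. \<rho> [] i * P q0 i u)" for u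
  proof -
    have "(\<Sum>v\<in>Le q0 u. S v) = (\<Sum>v\<in>Le q0 u. \<Sum>i<r. \<rho> [] i * g i v)"
      using S[of "[]"] by (intro sum.cong) (auto simp: Le_def)
    also have "\<dots> = (\<Sum>i<r. \<rho> [] i * P q0 i u)"
      unfolding P_def sum_distrib_left by (rule sum.swap)
    finally show ?thesis .
  qed
  define T where "T u = (SIGMA q:Q. Eq q u \<times> W q)" for u
  have R_decomp: "R `` {u} = Le q0 u \<union> (\<lambda>(q, v, w). w @ v) ` T u" if u: "u \<in> lists A" for u
  proof (intro equalityI subsetI)
    fix v assume uv: "v \<in> R `` {u}"
    then have v: "v \<in> lists B"
      using assms(3) by auto
    then have acc: "foldl \<delta> q0 (pad_pair u v) \<in> Fin"
      using uv R[OF u] by blast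
    show "v \<in> Le q0 u \<union> (\<lambda>(q, v, w). w @ v) ` T u"
    proof (cases "length v \<le> length u")
      case True
      then show ?thesis using v acc by (auto simp: Le_def)
    next
      case False
      define w v' where "w = take (length v - length u) v" and "v' = drop (length v - length u) v"
      have v_eq: "v = w @ v'" and len: "length v' = length u" and "w \<noteq> []"
        using False by (auto simp: w_def v'_def)
      define q where "q = foldl \<delta> q0 (map (\<lambda>b. (None, Some b)) w)"
      have mem: "w \<in> lists B" "v' \<in> lists B" using v v_eq by auto
      have "q \<in> Q"
        unfolding q_def
      proof (rule foldl_mem)
        show "map (\<lambda>b. (None, Some b)) w \<in> lists (pad_alphabet A B)"
          using mem by (auto simp: pad_alphabet_def)
      qed (use \<delta> Q in auto)
      moreover have "v' \<in> Eq q u"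
        using acc mem len unfolding v_eq pad_pair_append_right[OF len] by (simp add: Eq_def q_def)
      moreover have "w \<in> W q"
        using mem \<open>w \<noteq> []\<close> by (simp add: W_def q_def)
      ultimately have "(q, v', w) \<in> T u" by (simp add: T_def)
      then show ?thesis using v_eq by force
    qed
  next
    fix v assume "v \<in> Le q0 u \<union> (\<lambda>(q, v, w). w @ v) ` T u"
    then have "v \<in> lists B \<and> foldl \<delta> q0 (pad_pair u v) \<in> Fin"
      by (auto simp: T_def Le_def Eq_def W_def pad_pair_append_right)
    then show "v \<in> R `` {u}"
      using R[OF u] by blast
  qed
  have Eq_empty: "Eq q u = {}" if "infinite (W q)" "q \<in> Q" and u: "u \<in> lists A" for q u
  proof (rule ccontr)
    assume "Eq q u \<noteq> {}"
    then obtain v where "v \<in> Eq q u" by auto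
    then have "(\<lambda>w. w @ v) ` W q \<subseteq> R `` {u}"
      unfolding R_decomp[OF u] T_def using that(2) by force
    then have "finite ((\<lambda>w. w @ v) ` W q)"
      using assms(6)[OF u] finite_subset by blast
    moreover have "inj_on (\<lambda>w. w @ v) (W q)" by (auto simp: inj_on_def)
    ultimately show False using that(1) finite_imageD by blast
  qed
  have long: "(\<Sum>v\<in>(\<lambda>(q, v, w). w @ v) ` T u. S v) = (\<Sum>q\<in>Q. \<Sum>j<r. L q j * E q j u)"
    if u: "u \<in> lists A" for u
  proof -
    have fin: "finite (Eq q u \<times> W q)" if "q \<in> Q" for q
      using finEq Eq_empty[OF _ that u] by (cases "finite (W q)") auto
    \<comment> \<open>The length of \<open>u\<close> fixes where \<open>w @ v\<close> is cut, and
      \<open>w\<close> determines the state \<open>q\<close>.\<close>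
    have "inj_on (\<lambda>(q, v, w). w @ v) (T u)"
      by (auto simp: inj_on_def T_def Eq_def W_def)
    then have "(\<Sum>v\<in>(\<lambda>(q, v, w). w @ v) ` T u. S v) = (\<Sum>(q, v, w)\<in>T u. S (w @ v))"
      by (subst sum.reindex) (auto intro!: sum.cong)
    also have "\<dots> = (\<Sum>q\<in>Q. \<Sum>(v, w)\<in>Eq q u \<times> W q. S (w @ v))"
      unfolding T_def using Q(1) fin by (subst sum.Sigma) auto
    also have "\<dots> = (\<Sum>q\<in>Q. \<Sum>j<r. L q j * E q j u)"
    proof (rule sum.cong[OF refl])
      fix q assume "q \<in> Q"
      have "(\<Sum>(v, w)\<in>Eq q u \<times> W q. S (w @ v)) = (\<Sum>v\<in>Eq q u. \<Sum>w\<in>W q. \<Sum>j<r. \<rho> w j * g j v)"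
        unfolding sum.cartesian_product[symmetric]
        by (intro sum.cong refl S) (auto simp: Eq_def W_def)
      also have "\<dots> = (\<Sum>v\<in>Eq q u. \<Sum>j<r. L q j * g j v)"
        unfolding L_def sum_distrib_right by (intro sum.cong refl sum.swap)
      also have "\<dots> = (\<Sum>j<r. L q j * E q j u)"
        unfolding E_def sum_distrib_left by (rule sum.swap)
      finally show "(\<Sum>(v, w)\<in>Eq q u \<times> W q. S (w @ v)) = (\<Sum>j<r. L q j * E q j u)" .
    qed
    finally show ?thesis .
  qed
  have total: "(\<Sum>v\<in>R `` {u}. S v)
      = (\<Sum>i<r. \<rho> [] i * P q0 i u) + (\<Sum>q\<in>Q. \<Sum>j<r. L q j * E q j u)" if u: "u \<in> lists A" for u
  proof -
    have "finite ((\<lambda>(q, v, w). w @ v) ` T u)"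
      using assms(6)[OF u] unfolding R_decomp[OF u] by simp
    moreover have "Le q0 u \<inter> (\<lambda>(q, v, w). w @ v) ` T u = {}"
      by (auto simp: Le_def T_def Eq_def W_def)
    ultimately show ?thesis
      by (simp add: R_decomp[OF u] sum.union_disjoint[OF finLe] short long[OF u])
  qed
  show ?thesis
  proof (rule recognizable_if_mem_lspan[OF finF neF])
    show "(\<lambda>u. f (a # u)) \<in> lspan (lists A) F" if "f \<in> F" "a \<in> A" for f a
      using that E_shift P_shift by (auto simp: F_def)
    show "(\<lambda>u. \<Sum>v\<in>R `` {u}. S v) \<in> lspan (lists A) F"
      \<comment> \<open>\<open>total\<close> holds for \<open>u\<close> in \<open>lists A\<close>
        only, which suffices for \<open>lspan_cong\<close>.\<close>
      by (rule lspan_cong[OF _ total])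
        (intro lspan_add lspan_sum lspan_scale E_span P_span; use Q in simp)
  qed
qed

end
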